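(* Let $P$ be an oriented knot projection on $S^2$, and let $M(P)$ be the warping matrix of $P$. Then $$\mathrm{rank}\, M(P)=c(P)+1,$$ where $c(P)$ is the crossing number of $P$.
   Context: An oriented knot projection $P$ on $S^2$ is a generic immersion of an oriented circle in $S^2$ (its only singularities are finitely many transverse double points, called crossings); the crossing number $c(P)$ is the number of crossings of $P$. An oriented knot diagram $D$ on $S^2$ is an oriented knot projection with over/under information at each crossing. For a base point $b$ of $D$ avoiding crossings, a crossing $p$ is a warping crossing point of $D_b=(D,b)$ if, when traveling along $D$ from $b$ following the orientation, one meets $p$ first as an undercrossing. The warping degree $d(D_b)$ is the number of warping crossing points of $D_b$. An edge of $P$ is a part of $P$ between two crossings which has no crossings in its interior. Write $c=c(P)$. Take one base point on each edge of $P$ and label them $b_1,\dots,b_{2c}$ in order of traversal, starting from some edge. Giving over/under information at each crossing of $P$ in all possible ways yields $2^c$ knot diagrams $D^1,\dots,D^{2^c}$. The warping matrix $M(P)$ is the $2^c\times 2c$ matrix whose $(i,j)$ entry is $d(D^i_{b_j})$. It is considered up to permutations of rows and cyclic permutations of columns. Rank is the usual rank of a matrix.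
   Formalization: The projection P is assumed to have at least one crossing, c(P) ≥ 1; for a simple closed curve (c(P) = 0) the warping matrix is empty or zero, so its rank is 0 rather than c(P)+1 = 1. *)

theory Defs
  imports "HOL-Analysis.Analysis" "Jordan_Normal_Form.DL_Rank"
begin

text \<open>
  The oriented circle is the quotient of the reals by the integers, oriented by increasing
  parameter; a map from it to \<open>S\<^sup>2\<close> is a map of period 1 from the reals into the unit sphere
  of \<open>\<real>\<^sup>3\<close>.
\<close>

definition smooth_curve :: "(real \<Rightarrow> 'a::real_normed_vector) \<Rightarrow> bool" where
  "smooth_curve f \<longleftrightarrow>
     (\<forall>k t. (((\<lambda>g u. vector_derivative g (at u)) ^^ k) f) differentiable (at t))"

definition passages :: "(real \<Rightarrow> real^3) \<Rightarrow> real^3 \<Rightarrow> real set" where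
  "passages P x = {t \<in> {0..<1}. P t = x}"

definition crossings :: "(real \<Rightarrow> real^3) \<Rightarrow> (real^3) set" where
  "crossings P = {x. \<exists>s \<in> passages P x. \<exists>t \<in> passages P x. s \<noteq> t}"

definition crossing_number :: "(real \<Rightarrow> real^3) \<Rightarrow> nat" where
  "crossing_number P = card (crossings P)"

text \<open>
  Transversality at a double point \<open>x\<close> says that the two velocity vectors span the tangent plane
  of the sphere at \<open>x\<close>, which is the orthogonal complement of \<open>x\<close>.
\<close>

definition knot_projection :: "(real \<Rightarrow> real^3) \<Rightarrow> bool" where
  "knot_projection P \<longleftrightarrow>
     (\<forall>t. P (t + 1) = P t) \<and>
     (\<forall>t. P t \<in> sphere 0 1) \<and>
     smooth_curve P \<and>
     (\<forall>t. vector_derivative P (at t) \<noteq> 0) \<and>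
     finite (crossings P) \<and>
     (\<forall>x \<in> crossings P. card (passages P x) = 2) \<and>
     (\<forall>x \<in> crossings P. \<forall>s \<in> passages P x. \<forall>t \<in> passages P x. s \<noteq> t \<longrightarrow>
        Real_Vector_Spaces.span {vector_derivative P (at s), vector_derivative P (at t)}
          = {v. v \<bullet> x = 0})"

text \<open>
  The two ends of an edge may be the same crossing of the sphere (always so if there is just one
  crossing), so edges are described through the parameter interval they are the image of.
\<close>

definition edges :: "(real \<Rightarrow> real^3) \<Rightarrow> (real^3) set set" where
  "edges P = {P ` {s..t} | s t. s < t \<and> P s \<in> crossings P \<and> P t \<in> crossings P \<and>
                (\<forall>u \<in> {s<..<t}. P u \<notin> crossings P)}"

text \<open>
  A diagram on \<open>P\<close> assigns to each crossing the parameter in \<open>[0,1)\<close> of its over-strand; the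
  extensional function space makes diagrams with the same crossing information equal.
\<close>

definition diagrams :: "(real \<Rightarrow> real^3) \<Rightarrow> (real^3 \<Rightarrow> real) set" where
  "diagrams P = (\<Pi>\<^sub>E x \<in> crossings P. passages P x)"

text \<open>
  A base point is given by a real parameter \<open>b\<close>.  Here \<open>u\<close> is the time at which \<open>x\<close> is first met
  from \<open>b\<close> on, and \<^term>\<open>frac u\<close> identifies the strand that is then being followed.
\<close>

definition warping_crossing ::
    "(real \<Rightarrow> real^3) \<Rightarrow> (real^3 \<Rightarrow> real) \<Rightarrow> real \<Rightarrow> real^3 \<Rightarrow> bool" where
  "warping_crossing P D b x \<longleftrightarrow>
     x \<in> crossings P \<and>
     (\<exists>u \<ge> b. P u = x \<and> (\<forall>v. b \<le> v \<and> v < u \<longrightarrow> P v \<noteq> x) \<and> D x \<noteq> frac u)"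

definition warping_degree :: "(real \<Rightarrow> real^3) \<Rightarrow> (real^3 \<Rightarrow> real) \<Rightarrow> real \<Rightarrow> nat" where
  "warping_degree P D b = card {x. warping_crossing P D b x}"

text \<open>
  One base point on each edge, listed (from index 0) in order of traversal within one turn
  around the circle.
\<close>

definition base_points :: "(real \<Rightarrow> real^3) \<Rightarrow> (nat \<Rightarrow> real) \<Rightarrow> bool" where
  "base_points P b \<longleftrightarrow>
     (\<forall>j < 2 * crossing_number P. P (b j) \<notin> crossings P) \<and>
     (\<forall>e \<in> edges P. \<exists>!j. j < 2 * crossing_number P \<and> P (b j) \<in> e) \<and>
     (\<forall>i j. i < j \<and> j < 2 * crossing_number P \<longrightarrow> b i < b j \<and> b j < b i + 1)"

text \<open>
  The warping matrix is determined by \<open>P\<close> only up to the enumeration of the diagrams (permuting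
  rows) and the starting edge (cyclically permuting columns), hence a predicate.
\<close>

definition warping_matrix :: "(real \<Rightarrow> real^3) \<Rightarrow> real mat \<Rightarrow> bool" where
  "warping_matrix P M \<longleftrightarrow>
     (\<exists>D b. bij_betw D {..<2 ^ crossing_number P} (diagrams P) \<and> base_points P b \<and>
        M = Matrix.mat (2 ^ crossing_number P) (2 * crossing_number P)
              (\<lambda>(i, j). real (warping_degree P (D i) (b j))))"

end

theory Submission
  imports Defs
begin

text \<open>
  Write \<open>\<sigma> j x\<close> for the strand on which \<open>x\<close> is first met from \<open>b j\<close>; the \<open>(i, j)\<close> entry of the matrix
  counts the crossings \<open>x\<close> with \<open>D i x \<noteq> \<sigma> j x\<close>.  Encoding the two strands at each crossing by signs,
  this is half of the number of crossings minus half of the sum of the products of the two signs.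
  So every column is a combination of the all-ones vector and the \<open>c\<close> vectors of signs of \<open>D i x\<close>,
  which are independent because the diagrams realise all sign patterns.  Conversely, two base
  points on the edges just before and just after a passage through \<open>x\<close> give columns that differ,
  up to sign, by the vector of \<open>x\<close>; hence all \<open>c + 1\<close> vectors are in the column space.
\<close>

section \<open>Spans and dimensions of finite families of vectors\<close>

text \<open>Summing over an index set, where \<open>lincomb\<close> sums over a set of vectors,
  permits repetitions in \<open>v\<close>.\<close>

lemma (in vec_space) sum_in_span:
  assumes W: "W \<subseteq> carrier_vec n"
    and "finite I" "\<And>x. x \<in> I \<Longrightarrow> v x \<in> span W"
  shows "Matrix.vec n (\<lambda>i. \<Sum>x\<in>I. a x * v x $ i) \<in> span W"
  using assms(2,3)
proof (induction I rule: finite_induct)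
  case empty
  have "Matrix.vec n (\<lambda>i. \<Sum>x\<in>{}. a x * v x $ i) = 0\<^sub>v n" by auto
  then show ?case using in_spanI[of _ "\<lambda>_. 0" "{}" W] by simp
next
  case (insert x I)
  have vx: "v x \<in> carrier_vec n"
    using insert.prems span_closed[OF W] by simp
  have "Matrix.vec n (\<lambda>i. \<Sum>x\<in>insert x I. a x * v x $ i)
      = a x \<cdot>\<^sub>v v x + Matrix.vec n (\<lambda>i. \<Sum>x\<in>I. a x * v x $ i)"
    using insert.hyps vx by auto
  moreover have "a x \<cdot>\<^sub>v v x \<in> span W"
    by (rule smult_in_span) (use W insert.prems in auto)
  moreover have "Matrix.vec n (\<lambda>i. \<Sum>x\<in>I. a x * v x $ i) \<in> span W"
    using insert by auto
  ultimately show ?case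
    using span_add1[OF W] by simp
qed

text \<open>Independence of the family forces \<open>v\<close> to be injective, so the image is a
  basis of its span with \<open>card I\<close> elements.\<close>

lemma (in vec_space) dim_span_independent_family:
  assumes "finite I" "\<And>x. x \<in> I \<Longrightarrow> v x \<in> carrier_vec n"
    and indep: "\<And>a x. \<lbrakk>\<And>i. i < n \<Longrightarrow> (\<Sum>x\<in>I. a x * v x $ i) = 0; x \<in> I\<rbrakk> \<Longrightarrow> a x = 0"
  shows "vectorspace.dim class_ring (span_vs (v ` I)) = card I"
proof -
  have W: "v ` I \<subseteq> carrier_vec n" and fin: "finite (v ` I)" using assms by auto
  have inj: "inj_on v I"
  proof (rule inj_onI, rule ccontr)
    fix x y assume xy: "x \<in> I" "y \<in> I" "v x = v y" "x \<noteq> y"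
    \<comment> \<open>The coefficients of the relation \<open>v x - v y = 0\<close>, which is
      nontrivial because \<open>x\<close> and \<open>y\<close> differ.\<close>
    define a :: "_ \<Rightarrow> 'a" where "a z = (if z = x then 1 else 0) - (if z = y then 1 else 0)" for z
    have "(\<Sum>z\<in>I. a z * v z $ i) = 0" for i
    proof -
      have "(\<Sum>z\<in>I. a z * v z $ i)
          = (\<Sum>z\<in>I. (if z = x then v x $ i else 0) - (if z = y then v y $ i else 0))"
        using xy(4) by (intro sum.cong) (auto simp: a_def)
      also have "\<dots> = v x $ i - v y $ i"
        using xy(1,2) \<open>finite I\<close> by (simp add: sum_subtractf)
      finally show ?thesis using xy(3) by simp
    qed
    from indep[OF this xy(1)] show False using xy(4) by (simp add: a_def)
  qed
  have "lin_indpt (v ` I)"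
  proof (rule finite_lin_indpt2[OF fin])
    show "v ` I \<subseteq> carrier_vec n" by (rule W)
    fix a assume z: "lincomb a (v ` I) = 0\<^sub>v n"
    have "(\<Sum>x\<in>I. a (v x) * v x $ i) = 0" if "i < n" for i
    proof -
      have "(\<Sum>x\<in>I. a (v x) * v x $ i) = lincomb a (v ` I) $ i"
        by (simp add: lincomb_index[OF that W] sum.reindex[OF inj])
      then show ?thesis using z that by simp
    qed
    from indep[OF this] show "\<forall>w \<in> v ` I. a w = 0" by simp
  qed
  \<comment> \<open>\<open>dim_span\<close> asks for a maximal independent subset; an independent
    set is its own.\<close>
  then have "vectorspace.dim class_ring (span_vs (v ` I)) = card (v ` I)"
    by (intro dim_span) (use W fin in \<open>auto simp: maximal_def\<close>)
  then show ?thesis by (simp add: card_image[OF inj])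
qed

section \<open>The rank of a matrix counting mismatches\<close>

text \<open>The combinatorial core, free of geometry: rows are all choices of one of two strands per
  crossing, and \<open>flip\<close> provides two columns whose choices differ at \<open>x\<close>
  alone. With \<open>C\<close> empty all entries are 0, which is why \<open>ne\<close> is
  assumed.\<close>

lemma rank_mismatch_matrix:
  fixes D :: "nat \<Rightarrow> 'c \<Rightarrow> 'p" and \<sigma> :: "nat \<Rightarrow> 'c \<Rightarrow> 'p"
  assumes finC: "finite C" and ne: "C \<noteq> {}"
    and two: "\<And>x. x \<in> C \<Longrightarrow> card (Q x) = 2"
    and D: "bij_betw D {..<N} (\<Pi>\<^sub>E x\<in>C. Q x)"
    and \<sigma>: "\<And>j x. \<lbrakk>j < m; x \<in> C\<rbrakk> \<Longrightarrow> \<sigma> j x \<in> Q x"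
    and flip: "\<And>x. x \<in> C \<Longrightarrow> \<exists>j<m. \<exists>k<m. \<sigma> j x \<noteq> \<sigma> k x \<and> (\<forall>y\<in>C - {x}. \<sigma> j y = \<sigma> k y)"
  shows "vec_space.rank N (Matrix.mat N m (\<lambda>(i, j). real (card {x \<in> C. D i x \<noteq> \<sigma> j x}))) = card C + 1"
proof -
  interpret vec_space "TYPE(real)" N .
  define M where "M = Matrix.mat N m (\<lambda>(i, j). real (card {x \<in> C. D i x \<noteq> \<sigma> j x}))"
  have M: "M \<in> carrier_mat N m" by (simp add: M_def)
  have "\<forall>x\<in>C. \<exists>s t. s \<noteq> t \<and> Q x = {s, t}"
    using two by (meson card_2_iff)
  then obtain s t where st: "\<And>x. x \<in> C \<Longrightarrow> s x \<noteq> t x" "\<And>x. x \<in> C \<Longrightarrow> Q x = {s x, t x}"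
    by metis
  \<comment> \<open>\<open>s x\<close> gets the sign 1 and \<open>t x\<close> the sign -1, so two
    strands at \<open>x\<close> agree exactly when their signs have product 1.\<close>
  define \<epsilon> :: "'c \<Rightarrow> 'p \<Rightarrow> real" where "\<epsilon> x p = (if p = s x then 1 else - 1)" for x p
  \<comment> \<open>The expected basis of the column space: \<open>None\<close> indexes the all-ones
    vector, \<open>Some x\<close> the sign vector of \<open>x\<close>.\<close>
  define e where "e k = (case k of None \<Rightarrow> Matrix.vec N (\<lambda>i. 1) | Some x \<Rightarrow> Matrix.vec N (\<lambda>i. \<epsilon> x (D i x)))" for k
  define I where "I = insert None (Some ` C)"
  have finI: "finite I" and cardI: "card I = card C + 1"
    using finC by (simp_all add: I_def card_image)
  have sumI: "(\<Sum>k\<in>I. g k) = g None + (\<Sum>x\<in>C. g (Some x))" for g :: "_ \<Rightarrow> real"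
    using finC by (simp add: I_def sum.reindex)
  have e_carrier: "e k \<in> carrier_vec N" for k by (cases k) (simp_all add: e_def)
  have eW: "e ` I \<subseteq> carrier_vec N" using e_carrier by auto
  have DQ: "D i x \<in> {s x, t x}" if "i < N" "x \<in> C" for i x
    using that D st by (auto simp: bij_betw_def PiE_def Pi_def)
  have entry: "M $$ (i, j) = card C / 2 - (\<Sum>x\<in>C. \<epsilon> x (\<sigma> j x) * \<epsilon> x (D i x)) / 2"
    if ij: "i < N" "j < m" for i j
  proof -
    have "M $$ (i, j) = (\<Sum>x\<in>C. of_bool (D i x \<noteq> \<sigma> j x))"
      using ij finC by (simp add: M_def sum_of_bool_eq Int_def)
    also have "\<dots> = (\<Sum>x\<in>C. 1 / 2 - \<epsilon> x (\<sigma> j x) * \<epsilon> x (D i x) / 2)"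
    proof (rule sum.cong[OF refl])
      fix x assume x: "x \<in> C"
      show "of_bool (D i x \<noteq> \<sigma> j x) = 1 / 2 - \<epsilon> x (\<sigma> j x) * \<epsilon> x (D i x) / 2"
        using DQ[OF ij(1) x] \<sigma>[OF ij(2) x] st[OF x] by (auto simp: \<epsilon>_def)
    qed
    finally show ?thesis by (simp add: sum_subtractf sum_divide_distrib)
  qed
  have colsW: "set (cols M) \<subseteq> carrier_vec N" using cols_dim[of M] M by simp
  have col_in: "Matrix.col M j \<in> span (set (cols M))" if "j < m" for j
    by (rule span_mem[OF colsW]) (use that M in \<open>auto simp: cols_def\<close>)
  have "span (set (cols M)) = span (e ` I)"
  proof
    have "Matrix.col M j \<in> span (e ` I)" if j: "j < m" for j
    proof -
      \<comment> \<open>Read off from \<open>entry\<close>: the coefficients depend on the column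
        only, not on the row.\<close>
      define a where "a k = (case k of None \<Rightarrow> card C / 2 | Some x \<Rightarrow> - \<epsilon> x (\<sigma> j x) / 2)" for k
      have "Matrix.col M j = Matrix.vec N (\<lambda>i. \<Sum>k\<in>I. a k * e k $ i)"
        using M j by (auto simp: sumI a_def e_def entry sum_divide_distrib sum_negf)
      then show ?thesis
        using sum_in_span[OF eW finI, of e a] span_mem[OF eW] by simp
    qed
    then have "set (cols M) \<subseteq> span (e ` I)"
      using M by (auto simp: cols_def)
    then show "span (set (cols M)) \<subseteq> span (e ` I)"
      using span_subsetI[OF eW] by blast
  next
    have eps: "e (Some x) \<in> span (set (cols M))" if x: "x \<in> C" for x
    proof -
      obtain j k where jk: "j < m" "k < m" "\<sigma> j x \<noteq> \<sigma> k x" and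
        eq: "\<forall>y\<in>C - {x}. \<sigma> j y = \<sigma> k y" using flip[OF x] by blast
      have *: "\<epsilon> x (\<sigma> k x) = - \<epsilon> x (\<sigma> j x)" and **: "\<epsilon> x (\<sigma> j x) * \<epsilon> x (\<sigma> j x) = 1"
        using \<sigma>[OF jk(1) x] \<sigma>[OF jk(2) x] st[OF x] jk(3) by (auto simp: \<epsilon>_def)
      \<comment> \<open>By \<open>entry\<close>, column \<open>k\<close> minus column
        \<open>j\<close> is the sign of \<open>\<sigma> j x\<close> times \<open>e (Some x)\<close>;
        multiplying by that sign again, whose square is 1, leaves \<open>e (Some x)\<close>.\<close>
      define a where "a l = (if l = j then - \<epsilon> x (\<sigma> j x) else \<epsilon> x (\<sigma> j x))" for l
      have "e (Some x) $ i = (\<Sum>l\<in>{j,k}. a l * Matrix.col M l $ i)" if i: "i < N" for i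
      proof -
        have "(\<Sum>y\<in>C - {x}. \<epsilon> y (\<sigma> j y) * \<epsilon> y (D i y)) = (\<Sum>y\<in>C - {x}. \<epsilon> y (\<sigma> k y) * \<epsilon> y (D i y))"
          using eq by (intro sum.cong) auto
        then have "M $$ (i, k) - M $$ (i, j) = \<epsilon> x (\<sigma> j x) * \<epsilon> x (D i x)"
          using i jk finC x by (simp add: entry sum.remove[OF finC x] * field_simps)
        moreover have "j \<noteq> k" using jk by auto
        ultimately show ?thesis using i jk M **
          by (simp add: a_def e_def algebra_simps flip: right_diff_distrib)
      qed
      then have "e (Some x) = Matrix.vec N (\<lambda>i. \<Sum>l\<in>{j,k}. a l * Matrix.col M l $ i)"
        using e_carrier[of "Some x"] by auto
      also have "\<dots> \<in> span (set (cols M))"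
        by (rule sum_in_span[OF colsW]) (use jk col_in in auto)
      finally show ?thesis .
    qed
    have "e None \<in> span (set (cols M))"
    proof -
      obtain j where j: "j < m" using flip ne by blast
      \<comment> \<open>The family \<open>v\<close> puts column \<open>j\<close> in place of the
        all-ones vector. Solving \<open>entry\<close> for the constant 1 gives the coefficients
        \<open>a\<close>; the division by \<open>card C\<close> needs a crossing.\<close>
      define v where "v k = (case k of None \<Rightarrow> Matrix.col M j | Some x \<Rightarrow> e (Some x))" for k
      define a where "a k = (case k of None \<Rightarrow> 2 / card C | Some x \<Rightarrow> \<epsilon> x (\<sigma> j x) / card C)" for k
      have C0: "card C \<noteq> 0" using finC ne by simp
      have "(\<Sum>k\<in>I. a k * v k $ i) = 1" if i: "i < N" for i
      proof -
        have "(\<Sum>k\<in>I. a k * v k $ i)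
            = 2 / card C * M $$ (i, j) + (\<Sum>x\<in>C. \<epsilon> x (\<sigma> j x) * \<epsilon> x (D i x)) / card C"
          using M i j by (simp add: sumI a_def v_def e_def sum_divide_distrib)
        then show ?thesis using C0 by (simp add: entry[OF i j] field_simps)
      qed
      then have "e None = Matrix.vec N (\<lambda>i. \<Sum>k\<in>I. a k * v k $ i)"
        by (auto simp: e_def)
      also have "\<dots> \<in> span (set (cols M))"
        by (rule sum_in_span[OF colsW finI])
          (use j eps col_in in \<open>auto simp: I_def v_def\<close>)
      finally show ?thesis .
    qed
    with eps have "e ` I \<subseteq> span (set (cols M))" by (auto simp: I_def)
    then show "span (e ` I) \<subseteq> span (set (cols M))"
      using span_subsetI[OF colsW] by blast
  qed
  moreover have "vectorspace.dim class_ring (span_vs (e ` I)) = card I"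
  proof (rule dim_span_independent_family[OF finI e_carrier])
    fix a k assume z: "\<And>i. i < N \<Longrightarrow> (\<Sum>k\<in>I. a k * e k $ i) = 0" and k: "k \<in> I"
    \<comment> \<open>Every choice of strands is a row, so a relation between the vectors may be
      tested on any \<open>f\<close>.\<close>
    have z': "a None + (\<Sum>x\<in>C. a (Some x) * \<epsilon> x (f x)) = 0" if f: "f \<in> (\<Pi>\<^sub>E x\<in>C. Q x)" for f
    proof -
      have "f \<in> D ` {..<N}" unfolding bij_betw_imp_surj_on[OF D] by (rule f)
      then obtain i where i: "i < N" "D i = f" by (elim imageE) simp
      show ?thesis using z[OF i(1)] i by (simp add: sumI e_def)
    qed
    have aS: "a (Some x) = 0" if x: "x \<in> C" for x
    proof -
      \<comment> \<open>Switching the strand at \<open>x\<close> alone changes the relation by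
        \<open>2 * a (Some x)\<close>, which therefore vanishes.\<close>
      define f where "f = restrict s C"
      have f: "f \<in> (\<Pi>\<^sub>E x\<in>C. Q x)" "f(x := t x) \<in> (\<Pi>\<^sub>E x\<in>C. Q x)"
        using st(2) x by (auto simp: f_def PiE_iff extensional_def)
      have "(\<Sum>y\<in>C - {x}. a (Some y) * \<epsilon> y ((f(x := t x)) y)) = (\<Sum>y\<in>C - {x}. a (Some y) * \<epsilon> y (f y))"
        by (intro sum.cong) auto
      then show ?thesis
        using z'[OF f(1)] z'[OF f(2)] st(1)[OF x] x
        by (simp add: sum.remove[OF finC x] \<epsilon>_def f_def)
    qed
    have "restrict s C \<in> (\<Pi>\<^sub>E x\<in>C. Q x)" using st(2) by auto
    from z'[OF this] aS have "a None = 0" by simp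
    with aS k show "a k = 0" by (auto simp: I_def)
  qed
  ultimately show ?thesis
    unfolding rank_def M_def[symmetric] by (simp add: cardI)
qed

section \<open>Periodicity and the parameters of crossings\<close>

lemma periodic_shift_int:
  fixes P :: "real \<Rightarrow> 'a" and n :: int
  assumes "\<And>t. P (t + 1) = P t"
  shows "P (t + of_int n) = P t"
proof (induction n arbitrary: t rule: int_induct[where k = 0])
  case (step1 i)
  then show ?case using assms[of "t + of_int i"] by (simp add: algebra_simps)
next
  case (step2 i)
  then show ?case using assms[of "t + of_int (i - 1)"] by (simp add: algebra_simps)
qed simp

lemma knot_projection_periodic:
  assumes "knot_projection P"
  shows "P (t + of_int n) = P t"
  using assms by (intro periodic_shift_int) (simp add: knot_projection_def)

lemma knot_projection_frac:
  assumes "knot_projection P"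
  shows "P (frac t) = P t"
  using knot_projection_periodic[OF assms, of t "- \<lfloor>t\<rfloor>"] by (simp add: frac_def)

lemma frac_in_passages:
  assumes "knot_projection P"
  shows "frac t \<in> passages P (P t)"
  using knot_projection_frac[OF assms] by (simp add: passages_def frac_ge_0 frac_lt_1)

lemma frac_eq_imp_diff_int:
  fixes s t :: real
  assumes "frac s = frac t"
  obtains n :: int where "t = s + of_int n"
  by (rule that[of "\<lfloor>t\<rfloor> - \<lfloor>s\<rfloor>"]) (use assms in \<open>simp add: frac_def\<close>)

text \<open>Different fractional parts would be two passages through the same point, which would
  make it a crossing.\<close>

lemma frac_eq_if_not_crossing:
  assumes K: "knot_projection P" and "P s \<notin> crossings P" "P s = P t"
  shows "frac s = frac t"
  using frac_in_passages[OF K, of s] frac_in_passages[OF K, of t] assms(2,3)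
  by (auto simp: crossings_def)

lemma shift_into_interval:
  fixes t a :: real
  obtains n :: int where "a \<le> t + of_int n" "t + of_int n < a + 1"
  by (rule that[of "- \<lfloor>t - a\<rfloor>"]; simp; linarith)

text \<open>There are finitely many crossing parameters in \<open>[0,1)\<close>, and finitely many
  integer translates of them meet a bounded interval. This makes next and previous crossing
  parameters available.\<close>

lemma finite_crossing_parameters:
  assumes K: "knot_projection P"
  shows "finite {t. a \<le> t \<and> t \<le> b \<and> P t \<in> crossings P}"
proof -
  define Q where "Q = (\<Union>x\<in>crossings P. passages P x)"
  \<comment> \<open>An infinite set has cardinality 0, so cardinality 2 entails finiteness.\<close>
  have "finite (passages P x)" if "x \<in> crossings P" for x
    using K that by (intro card_ge_0_finite) (auto simp: knot_projection_def)
  then have "finite Q" using K by (auto simp: Q_def knot_projection_def)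
  moreover have "{t. a \<le> t \<and> t \<le> b \<and> P t \<in> crossings P}
      \<subseteq> (\<lambda>(q, n). q + of_int n) ` (Q \<times> {\<lfloor>a\<rfloor>..\<lfloor>b\<rfloor>})"
  proof
    fix t assume t: "t \<in> {t. a \<le> t \<and> t \<le> b \<and> P t \<in> crossings P}"
    then have "frac t \<in> Q" using frac_in_passages[OF K, of t] by (auto simp: Q_def)
    moreover have "\<lfloor>t\<rfloor> \<in> {\<lfloor>a\<rfloor>..\<lfloor>b\<rfloor>}" using t by (auto intro: floor_mono)
    moreover have "t = frac t + of_int \<lfloor>t\<rfloor>" by (simp add: frac_def)
    ultimately show "t \<in> (\<lambda>(q, n). q + of_int n) ` (Q \<times> {\<lfloor>a\<rfloor>..\<lfloor>b\<rfloor>})" by force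
  qed
  ultimately show ?thesis by (meson finite_SigmaI finite_atLeastAtMost_int finite_imageI finite_subset)
qed

section \<open>First visits to a crossing\<close>

text \<open>The time quantified in \<open>warping_crossing\<close>, made into a function of base
  point and crossing.\<close>

definition first_visit :: "(real \<Rightarrow> real^3) \<Rightarrow> real \<Rightarrow> real^3 \<Rightarrow> real" where
  "first_visit P b x = (THE u. u \<ge> b \<and> P u = x \<and> (\<forall>v. b \<le> v \<and> v < u \<longrightarrow> P v \<noteq> x))"

lemma first_visitI:
  assumes "b \<le> u" "P u = x" "\<And>v. \<lbrakk>b \<le> v; v < u\<rbrakk> \<Longrightarrow> P v \<noteq> x"
  shows "first_visit P b x = u"
  unfolding first_visit_def
proof (rule the_equality)
  fix w assume w: "w \<ge> b \<and> P w = x \<and> (\<forall>v. b \<le> v \<and> v < w \<longrightarrow> P v \<noteq> x)"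
  have "\<not> u < w" using w assms(1,2) by blast
  moreover have "\<not> w < u" using w assms(3) by blast
  ultimately show "w = u" by simp
qed (use assms in auto)

text \<open>By periodicity \<open>x\<close> is met within one turn from \<open>b\<close>, and only
  finitely often, so there is a least time.\<close>

lemma first_visit:
  assumes K: "knot_projection P" and x: "x \<in> crossings P"
  shows "first_visit P b x \<ge> b" "P (first_visit P b x) = x"
    "\<And>v. \<lbrakk>b \<le> v; v < first_visit P b x\<rbrakk> \<Longrightarrow> P v \<noteq> x"
proof -
  obtain t where "P t = x" using x by (auto simp: crossings_def passages_def)
  moreover obtain n :: int where "b \<le> t + of_int n" "t + of_int n < b + 1"
    by (rule shift_into_interval)
  ultimately have ne: "t + of_int n \<in> {u. b \<le> u \<and> u \<le> b + 1 \<and> P u = x}"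
    using knot_projection_periodic[OF K] by auto
  have fin: "finite {u. b \<le> u \<and> u \<le> b + 1 \<and> P u = x}"
    using finite_crossing_parameters[OF K, of b "b + 1"] x by (auto elim: rev_finite_subset)
  define m where "m = Min {u. b \<le> u \<and> u \<le> b + 1 \<and> P u = x}"
  have m: "m \<in> {u. b \<le> u \<and> u \<le> b + 1 \<and> P u = x}"
    unfolding m_def using fin ne by (intro Min_in) auto
  have le: "m \<le> v" if "b \<le> v" "v \<le> b + 1" "P v = x" for v
    unfolding m_def using fin that by (intro Min_le) auto
  \<comment> \<open>A time before \<open>m\<close> lies below \<open>b + 1\<close> anyway, so
    minimality in the window is minimality outright.\<close>
  have min: "P v \<noteq> x" if "b \<le> v" "v < m" for v
    using le[of v] m that by auto
  have "first_visit P b x = m"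
    by (rule first_visitI) (use m min in auto)
  then show "first_visit P b x \<ge> b" "P (first_visit P b x) = x"
    "\<And>v. \<lbrakk>b \<le> v; v < first_visit P b x\<rbrakk> \<Longrightarrow> P v \<noteq> x"
    using m min by simp_all
qed

text \<open>The time in the definition is unique, so the existential collapses to a comparison of
  strands; warping degrees thereby become mismatch counts.\<close>

lemma warping_crossing_iff:
  assumes K: "knot_projection P"
  shows "warping_crossing P D b x \<longleftrightarrow> x \<in> crossings P \<and> D x \<noteq> frac (first_visit P b x)"
proof (cases "x \<in> crossings P")
  case True
  have "D x \<noteq> frac u \<longleftrightarrow> D x \<noteq> frac (first_visit P b x)"
    if "b \<le> u" "P u = x" "\<forall>v. b \<le> v \<and> v < u \<longrightarrow> P v \<noteq> x" for u
    using first_visitI[of b u P x] that by simp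
  then show ?thesis
    unfolding warping_crossing_def using True first_visit[OF K True, of b] by blast
qed (simp add: warping_crossing_def)

text \<open>Base points on given edges are located only up to whole turns; this removes the
  turns.\<close>

lemma frac_first_visit_shift:
  assumes K: "knot_projection P" and x: "x \<in> crossings P"
  shows "frac (first_visit P (b + of_int n) x) = frac (first_visit P b x)"
proof -
  have "first_visit P (b + of_int n) x = first_visit P b x + of_int n"
  proof (rule first_visitI)
    fix v assume v: "b + of_int n \<le> v" "v < first_visit P b x + of_int n"
    show "P v \<noteq> x"
      using first_visit(3)[OF K x, of b "v - of_int n"] v
        knot_projection_periodic[OF K, of "v - of_int n" n] by simp
  qed (use first_visit[OF K x] knot_projection_periodic[OF K] in auto)
  then show ?thesis by (simp add: frac_def)
qed

text \<open>Moving the base point from \<open>b\<close> to \<open>b'\<close> passes the single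
  crossing parameter \<open>u\<close>. From \<open>b\<close> the strand at \<open>u\<close> comes
  first; from \<open>b'\<close> the other strand of \<open>P u\<close> is met before that one
  returns at \<open>u + 1\<close>. Every other crossing is first met no earlier than
  \<open>b'\<close> from either start.\<close>

lemma first_visit_across:
  assumes K: "knot_projection P" and u: "b < u" "u < b'"
    and x: "P u \<in> crossings P"
    and only: "\<And>v. \<lbrakk>b \<le> v; v \<le> b'; P v \<in> crossings P\<rbrakk> \<Longrightarrow> v = u"
  shows "frac (first_visit P b (P u)) \<noteq> frac (first_visit P b' (P u))"
    and "\<And>y. \<lbrakk>y \<in> crossings P; y \<noteq> P u\<rbrakk> \<Longrightarrow> first_visit P b y = first_visit P b' y"
proof -
  have b: "first_visit P b (P u) = u"
  proof (rule first_visitI)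
    fix v assume "b \<le> v" "v < u"
    then show "P v \<noteq> P u" using only[of v] u(2) x by auto
  qed (use u in auto)
  \<comment> \<open>The other strand through the crossing, next moved into the turn that starts at
    \<open>u\<close>.\<close>
  obtain w where w: "w \<in> passages P (P u)" "w \<noteq> frac u"
    using x by (auto simp: crossings_def)
  obtain n where n: "u \<le> w + of_int n" "w + of_int n < u + 1" by (rule shift_into_interval)
  have frac_w: "frac (w + of_int n) = w" and Pw: "P (w + of_int n) = P u"
    using w knot_projection_periodic[OF K, of w n] by (auto simp: passages_def frac_eq)
  have "w + of_int n \<noteq> u" using w(2) frac_w by auto
  then have "b' \<le> w + of_int n"
    using only[of "w + of_int n"] n(1) u(1) Pw x by fastforce
  then have less: "first_visit P b' (P u) \<le> w + of_int n"
    using first_visit(3)[OF K x, of b' "w + of_int n"] Pw by linarith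
  show "frac (first_visit P b (P u)) \<noteq> frac (first_visit P b' (P u))"
  proof
    assume "frac (first_visit P b (P u)) = frac (first_visit P b' (P u))"
    then have "frac u = frac (first_visit P b' (P u))" using b by simp
    then obtain m :: int where m: "first_visit P b' (P u) = u + of_int m"
      by (rule frac_eq_imp_diff_int)
    \<comment> \<open>The lower bound comes from \<open>u < b'\<close>, the upper one from the other
      strand being visited before \<open>u + 1\<close>.\<close>
    then have "0 < real_of_int m" "real_of_int m < 1"
      using less n first_visit(1)[OF K x, of b'] u by linarith+
    then show False by simp
  qed
  fix y assume y: "y \<in> crossings P" "y \<noteq> P u"
  have "first_visit P b y \<noteq> u" using first_visit(2)[OF K y(1), of b] y(2) by auto
  then have "b' \<le> first_visit P b y"
    using only[of "first_visit P b y"] first_visit(1,2)[OF K y(1), of b] y(1) by fastforce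
  then have "first_visit P b' y = first_visit P b y"
    by (intro first_visitI) (use first_visit[OF K y(1), of b] u in auto)
  then show "first_visit P b y = first_visit P b' y" by simp
qed

section \<open>Base points on the edges around a crossing\<close>

text \<open>\<open>base_points\<close> only places \<open>P (b j)\<close> on the image of the edge.
  Away from crossings \<open>P\<close> determines the parameter up to an integer, whence the shift
  \<open>n\<close>.\<close>

lemma base_point_in_gap:
  assumes K: "knot_projection P" and B: "base_points P b"
    and st: "s < t" "P s \<in> crossings P" "P t \<in> crossings P"
    and gap: "\<And>u. \<lbrakk>s < u; u < t\<rbrakk> \<Longrightarrow> P u \<notin> crossings P"
  obtains j n where "j < 2 * crossing_number P" "s < b j + of_int n" "b j + of_int n < t"
proof -
  have "P ` {s..t} \<in> edges P" unfolding edges_def mem_Collect_eq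
    by (rule exI[of _ s], rule exI[of _ t]) (use st gap in simp)
  then obtain j where j: "j < 2 * crossing_number P" "P (b j) \<in> P ` {s..t}"
    using B unfolding base_points_def by meson
  obtain v where Pv: "P (b j) = P v" and "v \<in> {s..t}" using j(2) by (rule imageE)
  then have v: "s \<le> v" "v \<le> t" "P (b j) = P v" by simp_all
  have nc: "P (b j) \<notin> crossings P" using B j by (simp add: base_points_def)
  then have "frac (b j) = frac v" using frac_eq_if_not_crossing[OF K] v by blast
  then obtain n :: int where "v = b j + of_int n" by (rule frac_eq_imp_diff_int)
  moreover have "v \<noteq> s" "v \<noteq> t" using nc v st by auto
  ultimately show ?thesis using that[of j n] j(1) v by simp
qed

text \<open>This supplies \<open>flip\<close> in \<open>rank_mismatch_matrix\<close>, using the two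
  edges adjacent to one passage \<open>u\<close> through \<open>x\<close>.\<close>

lemma base_points_flip:
  assumes K: "knot_projection P" and B: "base_points P b" and x: "x \<in> crossings P"
  shows "\<exists>j<2 * crossing_number P. \<exists>k<2 * crossing_number P.
    frac (first_visit P (b j) x) \<noteq> frac (first_visit P (b k) x) \<and>
    (\<forall>y\<in>crossings P - {x}. frac (first_visit P (b j) y) = frac (first_visit P (b k) y))"
proof -
  obtain u where u: "P u = x" using x by (auto simp: crossings_def passages_def)
  have Pu: "P (u - 1) = x" "P (u + 1) = x"
    using u knot_projection_periodic[OF K, of u 1] knot_projection_periodic[OF K, of u "-1"] by auto
  \<comment> \<open>The crossing \<open>x\<close> itself recurs at \<open>u - 1\<close> and
    \<open>u + 1\<close>, so both windows contain a crossing parameter other than \<open>u\<close>,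
    and its neighbours \<open>r\<close> and \<open>t\<close> exist.\<close>
  define L where "L = {t. u - 1 \<le> t \<and> t \<le> u \<and> P t \<in> crossings P} - {u}"
  define R where "R = {t. u \<le> t \<and> t \<le> u + 1 \<and> P t \<in> crossings P} - {u}"
  have LR: "finite L" "finite R" "u - 1 \<in> L" "u + 1 \<in> R"
    using finite_crossing_parameters[OF K] Pu x by (auto simp: L_def R_def)
  define r t where "r = Max L" and "t = Min R"
  have r: "r \<in> L" and t: "t \<in> R" using LR Max_in[of L] Min_in[of R] unfolding r_def t_def by blast+
  have gapL: "P v \<notin> crossings P" if "r < v" "v < u" for v
    using Max_ge[OF LR(1), of v] that r by (auto simp: r_def L_def)
  have gapR: "P v \<notin> crossings P" if "u < v" "v < t" for v
    using Min_le[OF LR(2), of v] that t by (auto simp: t_def R_def)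
  have r': "r < u" "P r \<in> crossings P" and t': "u < t" "P t \<in> crossings P"
    using r t by (auto simp: L_def R_def)
  obtain j m where j: "j < 2 * crossing_number P" "r < b j + of_int m" "b j + of_int m < u"
    by (rule base_point_in_gap[OF K B r'(1,2)]) (use u x gapL in auto)
  obtain k n where k: "k < 2 * crossing_number P" "u < b k + of_int n" "b k + of_int n < t"
    by (rule base_point_in_gap[OF K B t'(1) _ t'(2)]) (use u x gapR in auto)
  have only: "v = u" if "b j + of_int m \<le> v" "v \<le> b k + of_int n" "P v \<in> crossings P" for v
    using that gapL[of v] gapR[of v] j(2) k(3) by (cases v u rule: linorder_cases) auto
  note A = first_visit_across[OF K j(3) k(2), unfolded u, OF x only]
  \<comment> \<open>The shifts \<open>m\<close> and \<open>n\<close> may differ, for instance when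
    the list of base points starts with the edge after \<open>u\<close>; fractional parts ignore
    them.\<close>
  have "frac (first_visit P (b j) y) = frac (first_visit P (b k) y)" if "y \<in> crossings P - {x}" for y
    using A(2)[of y] that frac_first_visit_shift[OF K, of y] by (metis DiffE singletonI)
  moreover have "frac (first_visit P (b j) x) \<noteq> frac (first_visit P (b k) x)"
    using A(1) by (simp add: frac_first_visit_shift[OF K x])
  ultimately show ?thesis using j(1) k(1) by blast
qed

section \<open>The rank of the warping matrix\<close>

theorem theorem1p1:
  fixes P :: "real \<Rightarrow> real^3" and M :: "real mat"
  assumes "knot_projection P"
    and "crossing_number P \<ge> 1"
    and "warping_matrix P M"
  shows "vec_space.rank (dim_row M) M = crossing_number P + 1"
proof -
  note K = assms(1)
  obtain D b where D: "bij_betw D {..<2 ^ crossing_number P} (diagrams P)" and B: "base_points P b"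
    and M: "M = Matrix.mat (2 ^ crossing_number P) (2 * crossing_number P)
              (\<lambda>(i, j). real (warping_degree P (D i) (b j)))"
    using assms(3) unfolding warping_matrix_def by blast
  define \<sigma> where "\<sigma> j x = frac (first_visit P (b j) x)" for j x
  have M': "M = Matrix.mat (2 ^ crossing_number P) (2 * crossing_number P)
      (\<lambda>(i, j). real (card {x \<in> crossings P. D i x \<noteq> \<sigma> j x}))"
    unfolding M warping_degree_def warping_crossing_iff[OF K] \<sigma>_def ..
  have "vec_space.rank (2 ^ crossing_number P) M = card (crossings P) + 1"
    unfolding M'
  \<comment> \<open>The last obligation is the only one that rests on the base points
    \<open>B\<close>.\<close>
  proof (rule rank_mismatch_matrix)
    show "finite (crossings P)" using K by (simp add: knot_projection_def)
    show "crossings P \<noteq> {}" using assms(2) by (auto simp: crossing_number_def)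
    show "card (passages P x) = 2" if "x \<in> crossings P" for x
      using K that by (simp add: knot_projection_def)
    show "bij_betw D {..<2 ^ crossing_number P} (\<Pi>\<^sub>E x\<in>crossings P. passages P x)"
      using D by (simp add: diagrams_def)
    show "\<sigma> j x \<in> passages P x" if "x \<in> crossings P" for j x
      using frac_in_passages[OF K, of "first_visit P (b j) x"] first_visit(2)[OF K that]
      by (simp add: \<sigma>_def)
    show "\<exists>j<2 * crossing_number P. \<exists>k<2 * crossing_number P. \<sigma> j x \<noteq> \<sigma> k x \<and>
        (\<forall>y\<in>crossings P - {x}. \<sigma> j y = \<sigma> k y)" if "x \<in> crossings P" for x
      using base_points_flip[OF K B that] by (simp add: \<sigma>_def)
  qed
  then show ?thesis by (simp add: M crossing_number_def)
qed

end
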